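(* With the notation of the context, let $l:\mathbb{R}_+\to\mathbb{R}_+$ be a continuous strictly increasing convex function with $l(0)=0$, let $\delta>0$, let $\rho_l$ be the associated shortfall risk measure $$\rho_l(-x)=\inf\{c\in\mathbb{R}:\text{ there exists } m\in M\text{ such that }\mathbb{E}[l((c+m-x)^-)]\le\delta\},\quad x\in L,$$ and let $\widehat{\rho_l}(x)=\rho_l(x)-\rho_l(0)$ be its normalization. If $\widehat{\rho_l}\in\mathcal{R}$ (in particular $\widehat{\rho_l}$ is well defined), then $\widehat{\rho_l}$ is a GDV.
   Context: Setting. Let $(\Omega,\mathcal{F},\mathbb{P})$ be a complete probability space. A Young function is an even convex function $\Psi:\mathbb{R}\to\mathbb{R}\cup\{\infty\}$ with $\Psi(0)=0$, $\Psi(x)\uparrow\infty$ as $x\uparrow\infty$, and $\Psi(x)<\infty$ for $x$ in a neighborhood of $0$. The Orlicz space is $L^\Psi=\{X : \mathbb{E}[\Psi(cX)]<\infty \text{ for some } c>0\}$ with the gauge norm $\|X\|=\inf\{c>0:\mathbb{E}[\Psi(X/c)]\le 1\}$ and the almost sure pointwise order; the Orlicz heart is $M^\Psi=\{X\in L^\Psi : \mathbb{E}[\Psi(cX)]<\infty\text{ for all }c>0\}$. Fix a Young function $\Psi$ and let $L$ be either $L^\Psi$ or $M^\Psi$; constants are regarded as elements of $L$ (so $\Psi$ is finite-valued when $L=M^\Psi$). Put $L_-=\{x\in L:x\le 0\}$. Fix a convex cone $M\subset L$ with $L_-\subset M$ (the set of $0$-attainable claims). $\mathbb{E}$ is expectation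 under $\mathbb{P}$ and $y^-=\max(-y,0)$. Convex risk measures. A convex risk measure is a map $\rho:L\to(-\infty,+\infty]$ such that for all $x,y\in L$: $\rho(0)<\infty$; $\rho(x)\ge\rho(y)$ if $x\le y$; $\rho(x+c)=\rho(x)-c$ for $c\in\mathbb{R}$; $\rho(\lambda x+(1-\lambda)y)\le\lambda\rho(x)+(1-\lambda)\rho(y)$ for $\lambda\in[0,1]$. It has the Fatou property if for every increasing sequence $\{x_n\}\subset L$ with $x_n\uparrow x_\infty\in L$ a.s., $\rho(-x_n)\uparrow\rho(-x_\infty)$. Let $\mathcal{R}$ be the set of convex risk measures with $\rho(0)=0$ and the Fatou property. Superhedging cost: $\rho^0(x)=\inf\{c\in\mathbb{R}:\text{ there exists } m\in M\text{ such that } c+m+x\ge 0\}$ for $x\in L$. A good deal valuation (GDV) is a $\rho\in\mathcal{R}$ with $\rho(-x)\in[-\rho^0(x),\rho^0(-x)]$ for all $x\in L$. *)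

theory Defs
  imports "HOL-Probability.Probability"
begin

text \<open>
  Elements of the Orlicz space or heart are represented by random variables, that is,
  Borel functions on the probability space, rather than by their almost sure equivalence
  classes. No identification is needed: monotonicity in the almost sure order forces a convex
  risk measure to agree on almost surely equal claims, and a convex cone that contains
  all nonpositive claims is closed under almost sure equality.
\<close>

definition young_function :: "(real \<Rightarrow> ereal) \<Rightarrow> bool" where
  "young_function \<Psi> \<longleftrightarrow>
     (\<forall>x. \<Psi> x \<noteq> -\<infinity>) \<and>
     (\<forall>x. \<Psi> (- x) = \<Psi> x) \<and>
     (\<forall>x y. \<forall>t\<in>{0..1}.
        \<Psi> (t * x + (1 - t) * y) \<le> ereal t * \<Psi> x + ereal (1 - t) * \<Psi> y) \<and>
     \<Psi> 0 = 0 \<and>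
     mono_on {0..} \<Psi> \<and> (\<Psi> \<longlongrightarrow> \<infinity>) at_top \<and>
     (\<forall>\<^sub>F x in nhds 0. \<Psi> x < \<infinity>)"

text \<open>
  The expectation of \<open>\<Psi> (c X)\<close>. A Young function is nonnegative, so \<open>e2ennreal\<close>
  does not truncate.
\<close>

definition young_expectation :: "'a measure \<Rightarrow> (real \<Rightarrow> ereal) \<Rightarrow> real \<Rightarrow> ('a \<Rightarrow> real) \<Rightarrow> ennreal" where
  "young_expectation P \<Psi> c X = (\<integral>\<^sup>+ \<omega>. e2ennreal (\<Psi> (c * X \<omega>)) \<partial>P)"

definition orlicz_space :: "'a measure \<Rightarrow> (real \<Rightarrow> ereal) \<Rightarrow> ('a \<Rightarrow> real) set" where
  "orlicz_space P \<Psi> = {X \<in> borel_measurable P. \<exists>c>0. young_expectation P \<Psi> c X < \<infinity>}"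

definition orlicz_heart :: "'a measure \<Rightarrow> (real \<Rightarrow> ereal) \<Rightarrow> ('a \<Rightarrow> real) set" where
  "orlicz_heart P \<Psi> = {X \<in> orlicz_space P \<Psi>. \<forall>c>0. young_expectation P \<Psi> c X < \<infinity>}"

text \<open>
  The library's \<open>convex_cone\<close> needs an instance of \<open>real_vector\<close>, which the function type
  does not have.
\<close>

definition claim_cone :: "('a \<Rightarrow> real) set \<Rightarrow> bool" where
  "claim_cone M \<longleftrightarrow>
     M \<noteq> {} \<and>
     (\<forall>x\<in>M. \<forall>y\<in>M. \<forall>a\<ge>0. \<forall>b\<ge>0. (\<lambda>\<omega>. a * x \<omega> + b * y \<omega>) \<in> M)"

definition nonpositive_claims :: "'a measure \<Rightarrow> ('a \<Rightarrow> real) set \<Rightarrow> ('a \<Rightarrow> real) set" where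
  "nonpositive_claims P L = {x \<in> L. AE \<omega> in P. x \<omega> \<le> 0}"

text \<open>
  A risk measure on \<open>L\<close> is a function on all of \<open>'a \<Rightarrow> real\<close> of which only the values on
  \<open>L\<close> matter. In the convexity inequality \<open>0 * \<infinity> = 0\<close>.
\<close>

definition convex_risk_measure ::
    "'a measure \<Rightarrow> ('a \<Rightarrow> real) set \<Rightarrow> (('a \<Rightarrow> real) \<Rightarrow> ereal) \<Rightarrow> bool" where
  "convex_risk_measure P L \<rho> \<longleftrightarrow>
     (\<forall>x\<in>L. \<rho> x \<noteq> -\<infinity>) \<and>
     \<rho> (\<lambda>_. 0) < \<infinity> \<and>
     (\<forall>x\<in>L. \<forall>y\<in>L. (AE \<omega> in P. x \<omega> \<le> y \<omega>) \<longrightarrow> \<rho> y \<le> \<rho> x) \<and>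
     (\<forall>x\<in>L. \<forall>c::real. \<rho> (\<lambda>\<omega>. x \<omega> + c) = \<rho> x - ereal c) \<and>
     (\<forall>x\<in>L. \<forall>y\<in>L. \<forall>t\<in>{0..1}.
        \<rho> (\<lambda>\<omega>. t * x \<omega> + (1 - t) * y \<omega>) \<le> ereal t * \<rho> x + ereal (1 - t) * \<rho> y)"

definition fatou_property ::
    "'a measure \<Rightarrow> ('a \<Rightarrow> real) set \<Rightarrow> (('a \<Rightarrow> real) \<Rightarrow> ereal) \<Rightarrow> bool" where
  "fatou_property P L \<rho> \<longleftrightarrow>
     (\<forall>X x. (\<forall>n::nat. X n \<in> L) \<and> x \<in> L \<and>
        (AE \<omega> in P. incseq (\<lambda>n. X n \<omega>) \<and> (\<lambda>n. X n \<omega>) \<longlonglongrightarrow> x \<omega>) \<longrightarrow>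
        incseq (\<lambda>n. \<rho> (\<lambda>\<omega>. - X n \<omega>)) \<and>
        (\<lambda>n. \<rho> (\<lambda>\<omega>. - X n \<omega>)) \<longlonglongrightarrow> \<rho> (\<lambda>\<omega>. - x \<omega>))"

definition normalized_fatou_risk_measures ::
    "'a measure \<Rightarrow> ('a \<Rightarrow> real) set \<Rightarrow> (('a \<Rightarrow> real) \<Rightarrow> ereal) set" where
  "normalized_fatou_risk_measures P L =
     {\<rho>. convex_risk_measure P L \<rho> \<and> \<rho> (\<lambda>_. 0) = 0 \<and> fatou_property P L \<rho>}"

definition superhedging_cost ::
    "'a measure \<Rightarrow> ('a \<Rightarrow> real) set \<Rightarrow> ('a \<Rightarrow> real) \<Rightarrow> ereal" where
  "superhedging_cost P M x =
     (INF c \<in> {c::real. \<exists>m\<in>M. AE \<omega> in P. 0 \<le> c + m \<omega> + x \<omega>}. ereal c)"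

definition good_deal_valuation ::
    "'a measure \<Rightarrow> ('a \<Rightarrow> real) set \<Rightarrow> ('a \<Rightarrow> real) set \<Rightarrow> (('a \<Rightarrow> real) \<Rightarrow> ereal) \<Rightarrow> bool" where
  "good_deal_valuation P L M \<rho> \<longleftrightarrow>
     \<rho> \<in> normalized_fatou_risk_measures P L \<and>
     (\<forall>x\<in>L. \<rho> (\<lambda>\<omega>. - x \<omega>) \<in>
        {- superhedging_cost P M x .. superhedging_cost P M (\<lambda>\<omega>. - x \<omega>)})"

definition loss_function :: "(real \<Rightarrow> real) \<Rightarrow> bool" where
  "loss_function l \<longleftrightarrow>
     l ` {0..} \<subseteq> {0..} \<and> continuous_on {0..} l \<and> strict_mono_on {0..} l \<and>
     convex_on {0..} l \<and> l 0 = 0"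

text \<open>
  The shortfall risk measure is usually written for the liability \<open>-x\<close>, with shortfall
  \<open>(c + m - x)\<^sup>-\<close>; here the argument is the position itself, hence \<open>+ x\<close>. The
  expectation may be infinite, so it is a nonnegative Lebesgue integral.
\<close>

definition shortfall_risk ::
    "'a measure \<Rightarrow> ('a \<Rightarrow> real) set \<Rightarrow> (real \<Rightarrow> real) \<Rightarrow> real \<Rightarrow> ('a \<Rightarrow> real) \<Rightarrow> ereal" where
  "shortfall_risk P M l \<delta> x =
     (INF c \<in> {c::real. \<exists>m\<in>M.
         (\<integral>\<^sup>+ \<omega>. ennreal (l (max (- (c + m \<omega> + x \<omega>)) 0)) \<partial>P) \<le> ennreal \<delta>}. ereal c)"

text \<open>
  Since \<open>\<infinity> - \<infinity> = \<infinity>\<close> and \<open>-\<infinity> - (-\<infinity>) = \<infinity>\<close> in \<open>ereal\<close>, the value of \<open>normalization \<rho>\<close>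
  at \<open>0\<close> is \<open>0\<close> only if \<open>\<rho>\<close> is finite at \<open>0\<close>, that is, only if the normalization is
  well defined.
\<close>

definition normalization :: "(('a \<Rightarrow> real) \<Rightarrow> ereal) \<Rightarrow> ('a \<Rightarrow> real) \<Rightarrow> ereal" where
  "normalization \<rho> x = \<rho> x - \<rho> (\<lambda>_. 0)"

end

theory Submission
  imports Defs
begin

text \<open>
  If \<open>m\<close> in \<open>M\<close> satisfies \<open>y \<le> c + m + x\<close>, then a capital \<open>d\<close> and a claim \<open>m'\<close> acceptable for \<open>y\<close>
  yield \<open>c + d\<close> and \<open>m + m'\<close> acceptable for \<open>x\<close>, because \<open>M\<close> is closed under addition and the loss
  is monotone. Taking \<open>y = 0\<close> gives the upper bound of the valuation, and comparing the
  positions \<open>0\<close> and \<open>-x\<close> gives the lower one.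
\<close>

lemma loss_function_mono:
  assumes "loss_function l" and "0 \<le> a" and "a \<le> b"
  shows "l a \<le> l b"
  using assms unfolding loss_function_def
  by (auto dest!: strict_mono_on_imp_mono_on intro: mono_onD)

lemma claim_cone_add:
  assumes "claim_cone M" and "x \<in> M" and "y \<in> M"
  shows "(\<lambda>\<omega>. x \<omega> + y \<omega>) \<in> M"
proof -
  have "(\<lambda>\<omega>. 1 * x \<omega> + 1 * y \<omega>) \<in> M"
    using assms unfolding claim_cone_def by (meson zero_le_one)
  then show ?thesis by simp
qed

lemma shortfall_risk_le_add:
  assumes "claim_cone M" and "loss_function l" and "m \<in> M"
    and dom: "AE \<omega> in P. y \<omega> \<le> c + m \<omega> + x \<omega>"
  shows "shortfall_risk P M l \<delta> x \<le> shortfall_risk P M l \<delta> y + ereal c"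
proof -
  \<comment> \<open>With the real \<open>c\<close> moved to the left, the infimum for
    \<open>y\<close> stands alone on the right and can be bounded below element by element.\<close>
  have "shortfall_risk P M l \<delta> x - ereal c \<le> shortfall_risk P M l \<delta> y"
    unfolding shortfall_risk_def [of P M l \<delta> y]
  proof (rule INF_greatest)
    fix d :: real
    assume "d \<in> {d. \<exists>m\<in>M. (\<integral>\<^sup>+ \<omega>. ennreal (l (max (- (d + m \<omega> + y \<omega>)) 0)) \<partial>P) \<le> ennreal \<delta>}"
    then obtain m' where m': "m' \<in> M"
      and "(\<integral>\<^sup>+ \<omega>. ennreal (l (max (- (d + m' \<omega> + y \<omega>)) 0)) \<partial>P) \<le> ennreal \<delta>"
      by blast
    \<comment> \<open>By \<open>dom\<close>, almost surely the shortfall on the left is at most the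
      one on the right; truncation at 0 keeps both in the domain where \<open>l\<close> is
      monotone.\<close>
    moreover have "(\<integral>\<^sup>+ \<omega>. ennreal (l (max (- (c + d + (m \<omega> + m' \<omega>) + x \<omega>)) 0)) \<partial>P)
        \<le> (\<integral>\<^sup>+ \<omega>. ennreal (l (max (- (d + m' \<omega> + y \<omega>)) 0)) \<partial>P)"
      by (rule nn_integral_mono_AE, use dom in eventually_elim)
        (intro ennreal_leI loss_function_mono [OF assms(2)]; simp)
    ultimately have "shortfall_risk P M l \<delta> x \<le> ereal (c + d)"
      unfolding shortfall_risk_def
      using claim_cone_add [OF assms(1,3) m']
      by (intro INF_lower CollectI bexI [of _ "\<lambda>\<omega>. m \<omega> + m' \<omega>"]) auto
    then show "shortfall_risk P M l \<delta> x - ereal c \<le> ereal d"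
      by (simp add: ereal_minus_le add.commute)
  qed
  then show ?thesis by (simp add: ereal_minus_le)
qed

theorem proposition3p10:
  fixes P :: "'a measure"
    and \<Psi> :: "real \<Rightarrow> ereal"
    and L M :: "('a \<Rightarrow> real) set"
    and l :: "real \<Rightarrow> real"
    and \<delta> :: real
  assumes "prob_space P" and "complete_measure P"
    and "young_function \<Psi>"
    and "L = orlicz_space P \<Psi> \<or> (L = orlicz_heart P \<Psi> \<and> (\<forall>x. \<Psi> x < \<infinity>))"
    and "M \<subseteq> L" and "claim_cone M" and "nonpositive_claims P L \<subseteq> M"
    and "loss_function l" and "\<delta> > 0"
    and "normalization (shortfall_risk P M l \<delta>) \<in> normalized_fatou_risk_measures P L"
  shows "good_deal_valuation P L M (normalization (shortfall_risk P M l \<delta>))"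
proof -
  let ?S = "shortfall_risk P M l \<delta>"
  \<comment> \<open>In \<open>ereal\<close>, an infinite value minus itself is \<infinity>, so this
    equation forces the value at 0 to be a real \<open>r\<close>.\<close>
  have "?S (\<lambda>_. 0) - ?S (\<lambda>_. 0) = 0"
    using assms(10) by (simp add: normalized_fatou_risk_measures_def normalization_def)
  then obtain r where r: "?S (\<lambda>_. 0) = ereal r"
    by (cases "?S (\<lambda>_. 0)") auto
  note le_add = shortfall_risk_le_add [OF assms(6,8), where \<delta> = \<delta>]
  have "- superhedging_cost P M x \<le> normalization ?S (\<lambda>\<omega>. - x \<omega>)" for x
  proof -
    have "- normalization ?S (\<lambda>\<omega>. - x \<omega>) \<le> superhedging_cost P M x"
      unfolding superhedging_cost_def
    proof (rule INF_greatest)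
      fix c :: real
      assume "c \<in> {c. \<exists>m\<in>M. AE \<omega> in P. 0 \<le> c + m \<omega> + x \<omega>}"
      then obtain m where "m \<in> M" and m: "AE \<omega> in P. 0 \<le> c + m \<omega> + x \<omega>" by blast
      \<comment> \<open>The summand 0 makes the zero position the dominating one, so
        \<open>le_add\<close> bounds \<open>r\<close> by the risk of -x plus \<open>c\<close>; this
        also rules out the risk -\<infinity>.\<close>
      have "AE \<omega> in P. - x \<omega> \<le> c + m \<omega> + 0"
        using m by eventually_elim simp
      from le_add [OF \<open>m \<in> M\<close> this]
      show "- normalization ?S (\<lambda>\<omega>. - x \<omega>) \<le> ereal c"
        unfolding normalization_def r
        by (cases "?S (\<lambda>\<omega>. - x \<omega>)") (auto simp: r)
    qed
    then show ?thesis by (simp add: ereal_uminus_le_reorder)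
  qed
  moreover have "normalization ?S (\<lambda>\<omega>. - x \<omega>) \<le> superhedging_cost P M (\<lambda>\<omega>. - x \<omega>)" for x
    unfolding superhedging_cost_def
  proof (rule INF_greatest)
    fix c :: real
    assume "c \<in> {c. \<exists>m\<in>M. AE \<omega> in P. 0 \<le> c + m \<omega> + - x \<omega>}"
    then obtain m where "m \<in> M" and "AE \<omega> in P. 0 \<le> c + m \<omega> + - x \<omega>" by blast
    \<comment> \<open>Here the roles are swapped: the zero position is dominated, so the risk of -x
      is at most \<open>r\<close> plus \<open>c\<close>, hence finite or -\<infinity>.\<close>
    from le_add [OF this]
    show "normalization ?S (\<lambda>\<omega>. - x \<omega>) \<le> ereal c"
      unfolding normalization_def r
      by (cases "?S (\<lambda>\<omega>. - x \<omega>)") (auto simp: r)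
  qed
  ultimately show ?thesis
    using assms(10) by (simp add: good_deal_valuation_def)
qed

end
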